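(* Let $1\le l\le r$ and consider a canonical noiseless MMV model $B=AX$ in which $A$ satisfies $0\le\delta^L_{2k-r+l}(A)<1$ and the nonzero rows of $X$ are in general position. Let $I\subset\{1,\dots,n\}$ satisfy $|I|\le\min(2(k-r)+l,\,k)$ and $|I\setminus\operatorname{supp}X|\le k-r+l$. If $|I\cap\operatorname{supp}X|=k-r+q$ for some integer $q\ge0$, then $$\operatorname{rank}[A_I~B]=|I|+r-q.$$
   Context: Canonical MMV setting: $m,n,r,k$ are positive integers with $r\le m<n$ and $r\le k$. $A\in\mathbb{R}^{m\times n}$ is the sensing matrix with columns $\mathbf a_1,\dots,\mathbf a_n$; $X\in\mathbb{R}^{n\times r}$ has rows $\mathbf x^1,\dots,\mathbf x^n$, $\operatorname{supp}X=\{i:\mathbf x^i\neq 0\}$ and $|\operatorname{supp}X|=k$; $B=AX\in\mathbb{R}^{m\times r}$ has full column rank $r$. For an index set $I$, $A_I$ is the submatrix of $A$ formed by the columns indexed by $I$, and $[A_I~B]$ denotes horizontal concatenation. The lower restricted isometry constant $\delta^L_s(A)$ is the smallest $\delta\ge0$ such that $(1-\delta)\|\mathbf x\|_2^2\le\|A\mathbf x\|_2^2$ for all $\mathbf x$ with at most $s$ nonzero entries. "The nonzero rows of $X$ are in general position" means any $r$ of the $k$ nonzero rows of $X$ are linearly independent. *)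

theory Defs
  imports "HOL-Analysis.Analysis"
begin

text \<open>Row support of a matrix X (rows indexed by 'n).\<close>
definition row_supp :: "real^'r^'n \<Rightarrow> 'n set" where
  "row_supp X = {i. row i X \<noteq> 0}"

text \<open>Lower restricted isometry constant of order s.\<close>
definition lower_ric :: "nat \<Rightarrow> real^'n^'m \<Rightarrow> real" where
  "lower_ric s A = Inf {\<delta>. \<delta> \<ge> 0 \<and>
     (\<forall>x::real^'n. card {i. x $ i \<noteq> 0} \<le> s \<longrightarrow>
        (1 - \<delta>) * (norm x)^2 \<le> (norm (A *v x))^2)}"

text \<open>Rank of the concatenated matrix [A_I B]: dimension of its column space,
  i.e. of the span of the columns a_i (i in I) together with the columns of B.\<close>
definition rank_concat :: "real^'n^'m \<Rightarrow> 'n set \<Rightarrow> real^'r^'m \<Rightarrow> nat" where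
  "rank_concat A I B = dim ((\<lambda>i. column i A) ` I \<union> columns B)"

text \<open>Nonzero rows of X in general position: any r of them are linearly independent
  (as a family, hence in particular pairwise distinct).\<close>
definition rows_general_position :: "nat \<Rightarrow> real^'r^'n \<Rightarrow> bool" where
  "rows_general_position r X \<longleftrightarrow>
     (\<forall>S \<subseteq> row_supp X. card S = r \<longrightarrow>
        inj_on (\<lambda>i. row i X) S \<and> independent ((\<lambda>i. row i X) ` S))"

end

theory Submission
  imports Defs
begin

(*
  Write S = row_supp X, r = CARD('r), and let e_i denote the standard basis vectors.
  Since B = A X, the columns of [A_I B] are the images under A of the family
  G = {e_i | i \<in> I} \<union> columns X.  Every vector of span G is supported on I \<union> S,
  a set of at most 2k - r + l indices, so the lower RIP bound makes A injective
  on span G and rank [A_I B] = dim G.  Now span G = U + W with U the coordinate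
  subspace on I (dimension |I|) and W the column space of X (dimension r, because
  B has full column rank).  A vector X z lies in U iff z is orthogonal to the rows
  of X outside I, i.e. to the r - q rows indexed by S - I, which are independent by
  general position.  Hence dim (U \<inter> W) = q, and dim G = |I| + r - q.
*)

text \<open>Vectors supported on the index set \<open>J\<close>.\<close>
definition coord_subspace :: "('n::finite) set \<Rightarrow> (real^'n) set" where
  "coord_subspace J = {x. \<forall>i. i \<notin> J \<longrightarrow> x $ i = 0}"

lemma subspace_coord_subspace: "subspace (coord_subspace J)"
  unfolding coord_subspace_def subspace_def by auto

lemma dim_coord_subspace: "dim (coord_subspace J) = card J"
  using dim_substandard_cart[of J, where 'a=real] unfolding coord_subspace_def dim_vec_eq .

text \<open>The coordinate subspace on \<open>J\<close> is spanned by the basis vectors indexed by \<open>J\<close>.\<close>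
lemma span_axis_coord_subspace:
  "span ((\<lambda>i. axis i (1::real)) ` J) = coord_subspace J"
proof
  show "span ((\<lambda>i. axis i 1) ` J) \<subseteq> coord_subspace J"
    by (rule span_minimal[OF _ subspace_coord_subspace])
       (auto simp: coord_subspace_def axis_def)
  show "coord_subspace J \<subseteq> span ((\<lambda>i. axis i 1) ` J)"
  proof
    fix x assume x: "x \<in> coord_subspace J"
    have "x = (\<Sum>i\<in>UNIV. x $ i *s axis i 1)"
      by (rule basis_expansion[symmetric])
    also have "\<dots> = (\<Sum>i\<in>J. x $ i *s axis i 1)"
      by (rule sum.mono_neutral_cong_right) (use x in \<open>auto simp: coord_subspace_def\<close>)
    also have "\<dots> \<in> span ((\<lambda>i. axis i 1) ` J)"
      unfolding scalar_mult_eq_scaleR by (intro span_sum span_mul span_base) auto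
    finally show "x \<in> span ((\<lambda>i. axis i 1) ` J)" .
  qed
qed

text \<open>A lower restricted isometry constant below 1 forces every sufficiently sparse
  vector in the kernel of \<open>A\<close> to vanish.\<close>
lemma sparse_kernel_trivial:
  fixes A :: "real^'n^'m"
  assumes "lower_ric s A < 1" and "card {i. v $ i \<noteq> 0} \<le> s" and "A *v v = 0"
  shows "v = 0"
proof -
  let ?D = "{\<delta>. \<delta> \<ge> 0 \<and>
     (\<forall>x::real^'n. card {i. x $ i \<noteq> 0} \<le> s \<longrightarrow>
        (1 - \<delta>) * (norm x)^2 \<le> (norm (A *v x))^2)}"
  have "1 \<in> ?D" by simp
  then obtain d where d: "d \<in> ?D" "d < 1"
    using cInf_lessD[of ?D 1] assms(1) unfolding lower_ric_def by blast
  then have "(1 - d) * (norm v)^2 \<le> 0" using assms by auto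
  with \<open>d < 1\<close> have "(norm v)^2 \<le> 0" by (simp add: mult_le_0_iff)
  then show ?thesis by simp
qed

text \<open>Consequently \<open>A\<close> is injective on every coordinate subspace of dimension at most \<open>s\<close>.\<close>
lemma inj_on_coord_subspace:
  fixes A :: "real^'n^'m"
  assumes "lower_ric s A < 1" and "card J \<le> s"
  shows "inj_on ((*v) A) (coord_subspace J)"
proof (rule inj_onI)
  fix x y assume xy: "x \<in> coord_subspace J" "y \<in> coord_subspace J" "A *v x = A *v y"
  have "{i. (x - y) $ i \<noteq> 0} \<subseteq> J"
    using xy unfolding coord_subspace_def by auto (metis)
  then have "card {i. (x - y) $ i \<noteq> 0} \<le> s"
    using assms(2) card_mono[OF finite] le_trans by blast
  moreover have "A *v (x - y) = 0"
    using xy by (simp add: matrix_vector_mult_diff_distrib)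
  ultimately have "x - y = 0" using sparse_kernel_trivial[OF assms(1)] by blast
  then show "x = y" by simp
qed

text \<open>The column space of a matrix is the range of the associated linear map.\<close>
lemma span_columns_eq_range:
  fixes X :: "real^'r^'n"
  shows "span (columns X) = range ((*v) X)"
  unfolding columns_image_basis span_linear_image[OF matrix_vector_mul_linear]
  using span_axis_coord_subspace[of UNIV] by (auto simp: coord_subspace_def)

text \<open>The \<open>i\<close>-th entry of \<open>X z\<close> is the inner product of the \<open>i\<close>-th row with \<open>z\<close>.\<close>
lemma matrix_vector_component_row:
  fixes X :: "real^'r^'n"
  shows "(X *v z) $ i = row i X \<bullet> z"
  by (simp add: matrix_vector_mul_component row_def)

text \<open>Every vector \<open>X z\<close> is supported on the row support of \<open>X\<close>.\<close>
lemma range_subset_coord_row_supp: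
  fixes X :: "real^'r^'n"
  shows "range ((*v) X) \<subseteq> coord_subspace (row_supp X)"
  by (auto simp: coord_subspace_def row_supp_def matrix_vector_component_row)

text \<open>The orthogonal complement of a set has codimension equal to the dimension of the set.\<close>
lemma dim_orthogonal_complement:
  fixes R :: "'a::euclidean_space set"
  shows "dim {z. \<forall>v\<in>R. v \<bullet> z = 0} = DIM('a) - dim R"
proof -
  have "{z. \<forall>v\<in>R. v \<bullet> z = 0} = {z \<in> UNIV. \<forall>v \<in> span R. orthogonal v z}"
  proof (intro set_eqI iffI)
    fix z assume "z \<in> {z. \<forall>v\<in>R. v \<bullet> z = 0}"
    then show "z \<in> {z \<in> UNIV. \<forall>v \<in> span R. orthogonal v z}"
      using orthogonal_to_span[of _ R z] by (simp add: orthogonal_def inner_commute)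
  next
    fix z assume "z \<in> {z \<in> UNIV. \<forall>v \<in> span R. orthogonal v z}"
    then show "z \<in> {z. \<forall>v\<in>R. v \<bullet> z = 0}" by (simp add: orthogonal_def span_base)
  qed
  moreover have "dim {z \<in> UNIV. \<forall>v \<in> span R. orthogonal v z} + dim (span R) = DIM('a)"
    using dim_subspace_orthogonal_to_vectors[of "span R" UNIV] by simp
  ultimately show ?thesis by simp
qed

text \<open>A vector \<open>X z\<close> is supported on \<open>I\<close> iff \<open>z\<close> is orthogonal to all rows of \<open>X\<close>
  outside \<open>I\<close>; for injective \<open>X\<close> this determines the dimension of the intersection of
  the column space with the coordinate subspace on \<open>I\<close>.\<close>
lemma dim_range_inter_coord_subspace:
  fixes X :: "real^'r^'n"
  assumes "inj ((*v) X)"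
  shows "dim (range ((*v) X) \<inter> coord_subspace I) = CARD('r) - dim ((\<lambda>i. row i X) ` (- I))"
proof -
  define N where "N = {z. \<forall>v\<in>(\<lambda>i. row i X) ` (- I). v \<bullet> z = 0}"
  have "range ((*v) X) \<inter> coord_subspace I = (*v) X ` N"
    by (auto simp: N_def coord_subspace_def matrix_vector_component_row)
  then have "dim (range ((*v) X) \<inter> coord_subspace I) = dim N"
    using dim_image_eq[OF matrix_vector_mul_linear] assms by (metis inj_on_subset subset_UNIV)
  then show ?thesis
    unfolding N_def dim_orthogonal_complement by simp
qed


text \<open>Zero rows do not contribute to the span of a family of rows.\<close>
lemma dim_rows_outside:
  fixes X :: "real^'r^'n"
  shows "dim ((\<lambda>i. row i X) ` (- I)) = dim ((\<lambda>i. row i X) ` (row_supp X - I))"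
proof -
  have "(\<lambda>i. row i X) ` (- I) \<subseteq> insert 0 ((\<lambda>i. row i X) ` (row_supp X - I))"
    by (auto simp: row_supp_def)
  then have "(\<lambda>i. row i X) ` (- I) \<subseteq> span ((\<lambda>i. row i X) ` (row_supp X - I))"
    by (metis span_insert_0 span_superset subset_trans)
  moreover have "(\<lambda>i. row i X) ` (row_supp X - I) \<subseteq> span ((\<lambda>i. row i X) ` (- I))"
    by (intro subset_trans[OF _ span_superset]) auto
  ultimately show ?thesis
    by (metis dim_span span_eq)
qed

text \<open>If the nonzero rows of \<open>X\<close> are in general position, any at most \<open>r\<close> of them are
  linearly independent (provided there are at least \<open>r\<close> nonzero rows).\<close>
lemma dim_rows_general_position:
  fixes X :: "real^'r^'n"
  assumes "rows_general_position r X" and "r \<le> card (row_supp X)"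
    and "J \<subseteq> row_supp X" and "card J \<le> r"
  shows "dim ((\<lambda>i. row i X) ` J) = card J"
proof -
  obtain T where T: "J \<subseteq> T" "T \<subseteq> row_supp X" "card T = r"
    using exists_subset_between[of J r "row_supp X"] assms(2-4) by auto
  then have "inj_on (\<lambda>i. row i X) T" "independent ((\<lambda>i. row i X) ` T)"
    using assms(1) unfolding rows_general_position_def by auto
  then have "inj_on (\<lambda>i. row i X) J" "independent ((\<lambda>i. row i X) ` J)"
    using T(1) by (meson image_mono independent_mono inj_on_subset)+
  then show ?thesis
    by (simp add: dim_eq_card_independent card_image)
qed

text \<open>Dimension formula for the span of the basis vectors on \<open>I\<close> together with the
  columns of \<open>X\<close>: it is the sum of the coordinate subspace on \<open>I\<close> and the column space.\<close>
lemma dim_axis_columns: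
  fixes X :: "real^'r^'n"
  shows "dim ((\<lambda>i. axis i 1) ` I \<union> columns X) + dim (range ((*v) X) \<inter> coord_subspace I)
           = card I + rank X"
proof -
  have sum_eq: "span ((\<lambda>i. axis i 1) ` I \<union> columns X)
          = {x + y |x y. x \<in> coord_subspace I \<and> y \<in> range ((*v) X)}"
    unfolding span_Un span_axis_coord_subspace span_columns_eq_range by simp
  have "subspace (range ((*v) X))"
    unfolding span_columns_eq_range[symmetric] by (rule subspace_span)
  then have "dim {x + y |x y. x \<in> coord_subspace I \<and> y \<in> range ((*v) X)}
               + dim (coord_subspace I \<inter> range ((*v) X))
             = dim (coord_subspace I) + dim (range ((*v) X))"
    by (rule dim_sums_Int[OF subspace_coord_subspace])
  moreover have "dim ((\<lambda>i. axis i 1) ` I \<union> columns X)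
                   = dim {x + y |x y. x \<in> coord_subspace I \<and> y \<in> range ((*v) X)}"
    by (metis sum_eq dim_span)
  ultimately show ?thesis
    by (simp add: dim_coord_subspace rank_dim_range Int_commute)
qed

text \<open>The span of the basis vectors on \<open>I\<close> and the columns of \<open>X\<close> consists of
  vectors supported on \<open>I \<union> row_supp X\<close>.\<close>
lemma span_axis_columns_subset:
  fixes X :: "real^'r^'n"
  shows "span ((\<lambda>i. axis i 1) ` I \<union> columns X) \<subseteq> coord_subspace (I \<union> row_supp X)"
proof (rule span_minimal[OF _ subspace_coord_subspace])
  have mono: "coord_subspace J \<subseteq> coord_subspace (I \<union> row_supp X)" if "J \<subseteq> I \<union> row_supp X" for J
    using that unfolding coord_subspace_def by blast
  have "(\<lambda>i. axis i 1) ` I \<subseteq> coord_subspace I"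
    unfolding span_axis_coord_subspace[symmetric] by (rule span_superset)
  moreover have "columns X \<subseteq> coord_subspace (row_supp X)"
    using range_subset_coord_row_supp[of X] span_superset[of "columns X"]
    unfolding span_columns_eq_range by (rule subset_trans[rotated])
  ultimately show "(\<lambda>i. axis i 1) ` I \<union> columns X \<subseteq> coord_subspace (I \<union> row_supp X)"
    using mono[of I] mono[of "row_supp X"] by blast
qed

text \<open>If \<open>B = A X\<close>, the columns of \<open>[A_I B]\<close> are the images under \<open>A\<close> of the basis
  vectors on \<open>I\<close> and of the columns of \<open>X\<close>; so if \<open>A\<close> is injective on their span, the
  rank of the concatenation is the dimension of that family.\<close>
lemma rank_concat_factor:
  fixes A :: "real^'n^'m" and X :: "real^'r^'n"
  assumes "B = A ** X"
    and "inj_on ((*v) A) (span ((\<lambda>i. axis i 1) ` I \<union> columns X))"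
  shows "rank_concat A I B = dim ((\<lambda>i. axis i 1) ` I \<union> columns X)"
proof -
  have "(\<lambda>i. column i A) ` I = (*v) A ` (\<lambda>i. axis i 1) ` I"
    by (simp add: image_image matrix_vector_mult_basis)
  moreover have "columns B = (*v) A ` columns X"
    by (auto simp: columns_image_basis assms(1) matrix_vector_mul_assoc[symmetric] image_image)
  ultimately have "(\<lambda>i. column i A) ` I \<union> columns B = (*v) A ` ((\<lambda>i. axis i 1) ` I \<union> columns X)"
    by (simp add: image_Un)
  then show ?thesis
    unfolding rank_concat_def using dim_image_eq[OF matrix_vector_mul_linear assms(2)] by simp
qed

text \<open>A product of full column rank has a right factor of full column rank.\<close>
lemma rank_right_factor:
  fixes A :: "real^'n^'m" and X :: "real^'r^'n"
  assumes "rank (A ** X) = CARD('r)"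
  shows "rank X = CARD('r)"
  using rank_mul_le_right[of A X] rank_bound[of X] assms by simp

text \<open>Main result: the rank of \<open>[A_I B]\<close> is \<open>|I| + r - q\<close>.\<close>
theorem corollary2:
  fixes A :: "real^'n^'m" and X :: "real^'r^'n" and B :: "real^'r^'m"
    and k l q :: nat and I :: "'n set"
  assumes rm: "CARD('r) \<le> CARD('m)" and mn: "CARD('m) < CARD('n)"
    and rk: "CARD('r) \<le> k"
    and suppX: "card (row_supp X) = k"
    and BAX: "B = A ** X"
    and Brank: "rank B = CARD('r)"
    and l1: "1 \<le> l" and lr: "l \<le> CARD('r)"
    and ric0: "0 \<le> lower_ric (2 * k - CARD('r) + l) A"
    and ric1: "lower_ric (2 * k - CARD('r) + l) A < 1"
    and genpos: "rows_general_position CARD('r) X"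
    and Icard: "card I \<le> min (2 * (k - CARD('r)) + l) k"
    and Ioff: "card (I - row_supp X) \<le> k - CARD('r) + l"
    and Ion: "card (I \<inter> row_supp X) = k - CARD('r) + q"
  shows "rank_concat A I B = card I + CARD('r) - q"
proof -
  define S where "S = row_supp X"
  define G where "G = (\<lambda>i. axis i (1::real)) ` I \<union> columns X"
  have rankX: "rank X = CARD('r)"
    using Brank BAX rank_right_factor by blast
  have "card S = card (S \<inter> I) + card (S - I)"
    by (simp add: card_Int_Diff)
  then have off: "card (S - I) = CARD('r) - q" and q_le: "q \<le> CARD('r)"
    using Ion suppX rk by (simp_all add: S_def Int_commute)
  have "dim ((\<lambda>i. row i X) ` (S - I)) = CARD('r) - q"
    using dim_rows_general_position[OF genpos, of "S - I"] off rk suppX by (auto simp: S_def)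
  then have inter: "dim (range ((*v) X) \<inter> coord_subspace I) = q"
    using dim_range_inter_coord_subspace[of X I] dim_rows_outside[of X I] rankX q_le
    by (simp add: S_def full_rank_injective)
  have "card (I \<union> S) = card S + card (I - S)"
    using card_Int_Diff[of "I \<union> S" S] by (simp add: Un_Diff)
  then have "card (I \<union> S) \<le> 2 * k - CARD('r) + l"
    using Ioff suppX rk by (simp add: S_def)
  then have "inj_on ((*v) A) (coord_subspace (I \<union> S))"
    by (rule inj_on_coord_subspace[OF ric1])
  then have "inj_on ((*v) A) (span G)"
    unfolding G_def S_def using span_axis_columns_subset by (rule inj_on_subset)
  then have "rank_concat A I B = dim G"
    unfolding G_def by (rule rank_concat_factor[OF BAX])
  then show ?thesis
    using dim_axis_columns[of I X] inter rankX q_le by (simp add: G_def)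
qed

end
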